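(* Let $(\mathcal{A},[-,-],[-,-,-],\alpha)$ be a Hom-Akivis algebra and let $\beta:\mathcal{A}\to\mathcal{A}$ be a self-morphism of $(\mathcal{A},[-,-],[-,-,-],\alpha)$. Define on $\mathcal{A}$ a bilinear operation $[-,-]_\beta$ and a trilinear operation $[-,-,-]_\beta$ by $[x,y]_\beta:=\beta([x,y])$ and $[x,y,z]_\beta:=\beta^2([x,y,z])$ for all $x,y,z\in\mathcal{A}$, where $\beta^2=\beta\circ\beta$. Then $\mathcal{A}_\beta:=(\mathcal{A},[-,-]_\beta,[-,-,-]_\beta,\beta\circ\alpha)$ is a Hom-Akivis algebra. Moreover, if $(\mathcal{A},[-,-],[-,-,-],\alpha)$ is multiplicative and $\beta$ commutes with $\alpha$, then $\mathcal{A}_\beta$ is multiplicative.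
   Context: All vector spaces are over a field $\mathbb{K}$ of characteristic $0$. A Hom-Akivis algebra is a quadruple $(V,[-,-],[-,-,-],\alpha)$ where $V$ is a vector space, $[-,-]:V\times V\to V$ is a skew-symmetric bilinear map, $[-,-,-]:V\times V\times V\to V$ is a trilinear map and $\alpha:V\to V$ is a linear map such that $\sigma[[x,y],\alpha(z)]=\sigma[x,y,z]-\sigma[y,x,z]$ for all $x,y,z\in V$, where $\sigma$ denotes the sum over cyclic permutations of $x,y,z$. It is multiplicative if $\alpha$ is an endomorphism with respect to both $[-,-]$ and $[-,-,-]$, i.e. $\alpha([x,y])=[\alpha(x),\alpha(y)]$ and $\alpha([x,y,z])=[\alpha(x),\alpha(y),\alpha(z)]$. A morphism $\phi:(\mathcal{A},[-,-],[-,-,-],\alpha)\to(\tilde{\mathcal{A}},\{-,-\},\{-,-,-\},\tilde\alpha)$ of Hom-Akivis algebras is a linear map such that $\phi([x,y])=\{\phi(x),\phi(y)\}$ and $\phi([x,y,z])=\{\phi(x),\phi(y),\phi(z)\}$ for all $x,y,z$ (no compatibility with the twisting maps is required); a self-morphism is a morphism from a Hom-Akivis algebra to itself. *)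

theory Defs
  imports Complex_Main
begin

definition bilinear_map ::
    "('k::field \<Rightarrow> 'a::ab_group_add \<Rightarrow> 'a) \<Rightarrow> ('a \<Rightarrow> 'a \<Rightarrow> 'a) \<Rightarrow> bool" where
  "bilinear_map scale f \<longleftrightarrow>
     (\<forall>y. Vector_Spaces.linear scale scale (\<lambda>x. f x y)) \<and>
     (\<forall>x. Vector_Spaces.linear scale scale (\<lambda>y. f x y))"

definition trilinear_map ::
    "('k::field \<Rightarrow> 'a::ab_group_add \<Rightarrow> 'a) \<Rightarrow> ('a \<Rightarrow> 'a \<Rightarrow> 'a \<Rightarrow> 'a) \<Rightarrow> bool" where
  "trilinear_map scale f \<longleftrightarrow>
     (\<forall>y z. Vector_Spaces.linear scale scale (\<lambda>x. f x y z)) \<and>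
     (\<forall>x z. Vector_Spaces.linear scale scale (\<lambda>y. f x y z)) \<and>
     (\<forall>x y. Vector_Spaces.linear scale scale (\<lambda>z. f x y z))"

definition cyclic_sum :: "('a \<Rightarrow> 'a \<Rightarrow> 'a \<Rightarrow> 'b::ab_group_add) \<Rightarrow> 'a \<Rightarrow> 'a \<Rightarrow> 'a \<Rightarrow> 'b" where
  "cyclic_sum f x y z = f x y z + f y z x + f z x y"

locale hom_akivis_algebra = vector_space scale
  for scale :: "'k::field_char_0 \<Rightarrow> 'a::ab_group_add \<Rightarrow> 'a" +
  fixes br :: "'a \<Rightarrow> 'a \<Rightarrow> 'a"
    and tr :: "'a \<Rightarrow> 'a \<Rightarrow> 'a \<Rightarrow> 'a"
    and \<alpha> :: "'a \<Rightarrow> 'a"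
  assumes bilinear_br: "bilinear_map scale br"
    and skew_br: "br x y = - br y x"
    and trilinear_tr: "trilinear_map scale tr"
    and linear_twist: "Vector_Spaces.linear scale scale \<alpha>"
    and hom_akivis_identity:
      "cyclic_sum (\<lambda>x y z. br (br x y) (\<alpha> z)) x y z =
       cyclic_sum (\<lambda>x y z. tr x y z) x y z - cyclic_sum (\<lambda>x y z. tr y x z) x y z"

locale multiplicative_hom_akivis_algebra = hom_akivis_algebra +
  assumes twist_br: "\<alpha> (br x y) = br (\<alpha> x) (\<alpha> y)"
    and twist_tr: "\<alpha> (tr x y z) = tr (\<alpha> x) (\<alpha> y) (\<alpha> z)"

text \<open>Morphisms are not required to be compatible with the twisting maps.\<close>

locale hom_akivis_morphism =
  source: hom_akivis_algebra scale br tr \<alpha> +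
  target: hom_akivis_algebra scale' br' tr' \<alpha>'
  for scale :: "'k::field_char_0 \<Rightarrow> 'a::ab_group_add \<Rightarrow> 'a"
    and br tr \<alpha>
    and scale' :: "'k \<Rightarrow> 'b::ab_group_add \<Rightarrow> 'b"
    and br' tr' \<alpha>' +
  fixes \<phi> :: "'a \<Rightarrow> 'b"
  assumes linear_morphism: "Vector_Spaces.linear scale scale' \<phi>"
    and morphism_br: "\<phi> (br x y) = br' (\<phi> x) (\<phi> y)"
    and morphism_tr: "\<phi> (tr x y z) = tr' (\<phi> x) (\<phi> y) (\<phi> z)"

end

theory Submission
  imports Defs
begin

text \<open>Since \<open>\<beta>\<close> is a morphism,
  \<open>[[x,y]\<^sub>\<beta>, \<beta>(\<alpha>(z))]\<^sub>\<beta> = \<beta>\<^sup>2([[x,y],\<alpha>(z)])\<close>, so the Hom-Akivis identity of the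
  twisted algebra is the image under the linear map \<open>\<beta>\<^sup>2\<close> of the original one.\<close>

lemma bilinear_map_compose:
  assumes "Vector_Spaces.linear s s g" and "bilinear_map s f"
  shows "bilinear_map s (\<lambda>x y. g (f x y))"
proof -
  \<comment> \<open>Here \<open>h\<close> stands for a partial map of \<open>f\<close>, with all
    arguments but one fixed, so multilinearity reduces to composing linear maps.\<close>
  have "Vector_Spaces.linear s s (\<lambda>x. g (h x))" if "Vector_Spaces.linear s s h" for h
    using Vector_Spaces.linear_compose[OF that assms(1)] by (simp add: comp_def)
  with assms(2) show ?thesis
    by (simp add: bilinear_map_def)
qed

lemma trilinear_map_compose:
  assumes "Vector_Spaces.linear s s g" and "trilinear_map s f"
  shows "trilinear_map s (\<lambda>x y z. g (f x y z))"
proof -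
  have "Vector_Spaces.linear s s (\<lambda>x. g (h x))" if "Vector_Spaces.linear s s h" for h
    using Vector_Spaces.linear_compose[OF that assms(1)] by (simp add: comp_def)
  with assms(2) show ?thesis
    by (simp add: trilinear_map_def)
qed

text \<open>Additivity of \<open>g\<close> over the three summands; for \<open>g\<close> equal to
  \<open>\<beta> \<circ> \<beta>\<close> this carries the square through each cyclic sum of the
  identity.\<close>

lemma cyclic_sum_linear:
  assumes "Vector_Spaces.linear s s' g"
  shows "g (cyclic_sum f x y z) = cyclic_sum (\<lambda>x y z. g (f x y z)) x y z"
proof -
  interpret Vector_Spaces.linear s s' g by fact
  show ?thesis by (simp add: cyclic_sum_def add)
qed

lemma hom_akivis_algebra_twist:
  assumes "hom_akivis_morphism scale br tr \<alpha> scale br tr \<alpha> \<beta>"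
  shows "hom_akivis_algebra scale (\<lambda>x y. \<beta> (br x y)) (\<lambda>x y z. (\<beta> \<circ> \<beta>) (tr x y z)) (\<beta> \<circ> \<alpha>)"
proof -
  interpret \<beta>: hom_akivis_morphism scale br tr \<alpha> scale br tr \<alpha> \<beta> by fact
  interpret lin: Vector_Spaces.linear scale scale \<beta> by (fact \<beta>.linear_morphism)
  have lin2: "Vector_Spaces.linear scale scale (\<beta> \<circ> \<beta>)"
    by (rule Vector_Spaces.linear_compose[OF \<beta>.linear_morphism \<beta>.linear_morphism])
  interpret lin2: Vector_Spaces.linear scale scale "\<beta> \<circ> \<beta>" by (fact lin2)
  \<comment> \<open>With this in scope, opening the locale goal discharges linearity of the new
    twisting map, leaving the four properties shown below.\<close>
  interpret twist: Vector_Spaces.linear scale scale "\<beta> \<circ> \<alpha>"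
    by (rule Vector_Spaces.linear_compose[OF \<beta>.source.linear_twist \<beta>.linear_morphism])
  show ?thesis
  proof
    show "bilinear_map scale (\<lambda>x y. \<beta> (br x y))"
      by (rule bilinear_map_compose[OF \<beta>.linear_morphism \<beta>.source.bilinear_br])
    show "trilinear_map scale (\<lambda>x y z. (\<beta> \<circ> \<beta>) (tr x y z))"
      by (rule trilinear_map_compose[OF lin2 \<beta>.source.trilinear_tr])
    show "\<beta> (br x y) = - \<beta> (br y x)" for x y
      by (metis \<beta>.source.skew_br lin.neg)
    show "cyclic_sum (\<lambda>x y z. \<beta> (br (\<beta> (br x y)) ((\<beta> \<circ> \<alpha>) z))) x y z =
        cyclic_sum (\<lambda>x y z. (\<beta> \<circ> \<beta>) (tr x y z)) x y z -
        cyclic_sum (\<lambda>x y z. (\<beta> \<circ> \<beta>) (tr y x z)) x y z" for x y z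
    proof -
      \<comment> \<open>\<open>morphism_br\<close> pushes every \<beta> inward, so each summand on
        both sides becomes a bracket of \<open>\<beta> (\<beta> x)\<close>,
        \<open>\<beta> (\<beta> y)\<close> and \<open>\<beta> (\<beta> (\<alpha> z))\<close>.
        Nesting the twisted bracket yields two copies of \<beta>, which is why the ternary operation
        is twisted by the square.\<close>
      have "cyclic_sum (\<lambda>x y z. \<beta> (br (\<beta> (br x y)) ((\<beta> \<circ> \<alpha>) z))) x y z =
          (\<beta> \<circ> \<beta>) (cyclic_sum (\<lambda>x y z. br (br x y) (\<alpha> z)) x y z)"
        unfolding cyclic_sum_linear[OF lin2] by (simp add: \<beta>.morphism_br)
      then show ?thesis
        unfolding \<beta>.source.hom_akivis_identity lin2.diff cyclic_sum_linear[OF lin2] .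
    qed
  qed
qed

text \<open>Both \<alpha> and \<beta> preserve the original operations, hence so does their
  composite; since it commutes with \<beta>, it also preserves those operations followed by powers
  of \<beta>.\<close>

lemma multiplicative_hom_akivis_algebra_twist:
  assumes "hom_akivis_morphism scale br tr \<alpha> scale br tr \<alpha> \<beta>"
    and "multiplicative_hom_akivis_algebra scale br tr \<alpha>"
    and "\<beta> \<circ> \<alpha> = \<alpha> \<circ> \<beta>"
  shows "multiplicative_hom_akivis_algebra scale
    (\<lambda>x y. \<beta> (br x y)) (\<lambda>x y z. (\<beta> \<circ> \<beta>) (tr x y z)) (\<beta> \<circ> \<alpha>)"
proof -
  interpret \<beta>: hom_akivis_morphism scale br tr \<alpha> scale br tr \<alpha> \<beta> by fact
  interpret mult: multiplicative_hom_akivis_algebra scale br tr \<alpha> by fact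
  interpret twisted: hom_akivis_algebra scale
    "\<lambda>x y. \<beta> (br x y)" "\<lambda>x y z. (\<beta> \<circ> \<beta>) (tr x y z)" "\<beta> \<circ> \<alpha>"
    by (rule hom_akivis_algebra_twist) fact
  \<comment> \<open>Oriented so that \<beta> ends up outside \<alpha>: once all maps are pushed to
    the arguments, both sides of each equation share this normal form.\<close>
  have commute: "\<alpha> (\<beta> x) = \<beta> (\<alpha> x)" for x
    using fun_cong[OF assms(3), of x] by simp
  show ?thesis
    by unfold_locales
      (simp_all add: commute mult.twist_br mult.twist_tr \<beta>.morphism_br \<beta>.morphism_tr)
qed

theorem theorem4p4:
  fixes scale :: "'k::field_char_0 \<Rightarrow> 'a::ab_group_add \<Rightarrow> 'a"
    and br :: "'a \<Rightarrow> 'a \<Rightarrow> 'a"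
    and tr :: "'a \<Rightarrow> 'a \<Rightarrow> 'a \<Rightarrow> 'a"
    and \<alpha> \<beta> :: "'a \<Rightarrow> 'a"
    and br\<^sub>\<beta> :: "'a \<Rightarrow> 'a \<Rightarrow> 'a"
    and tr\<^sub>\<beta> :: "'a \<Rightarrow> 'a \<Rightarrow> 'a \<Rightarrow> 'a"
  assumes "hom_akivis_algebra scale br tr \<alpha>"
    and "hom_akivis_morphism scale br tr \<alpha> scale br tr \<alpha> \<beta>"
  defines "br\<^sub>\<beta> \<equiv> \<lambda>x y. \<beta> (br x y)"
    and "tr\<^sub>\<beta> \<equiv> \<lambda>x y z. (\<beta> \<circ> \<beta>) (tr x y z)"
  shows "hom_akivis_algebra scale br\<^sub>\<beta> tr\<^sub>\<beta> (\<beta> \<circ> \<alpha>) \<and>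
    (multiplicative_hom_akivis_algebra scale br tr \<alpha> \<and> \<beta> \<circ> \<alpha> = \<alpha> \<circ> \<beta> \<longrightarrow>
      multiplicative_hom_akivis_algebra scale br\<^sub>\<beta> tr\<^sub>\<beta> (\<beta> \<circ> \<alpha>))"
  unfolding br\<^sub>\<beta>_def tr\<^sub>\<beta>_def
  using hom_akivis_algebra_twist[OF assms(2)]
    multiplicative_hom_akivis_algebra_twist[OF assms(2)] by simp

end
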